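(* For any graphs $G$ and $H$, the tensor product $G\times H$ satisfies $$\mathrm{tww}(G\times H)\le \max\{\mathrm{tww}(G)\cdot\Delta(H)+\Delta(H),\ \mathrm{tww}(H)\}+\Delta(H).$$
   Context: All graphs are finite and simple (no loops or multiple edges). $\Delta(H)$ is the maximum degree of $H$. Twin-width. A trigraph $G$ has a vertex set $V(G)$, a set $E(G)$ of black edges and a set $R(G)$ of red edges, with $E(G)\cap R(G)=\emptyset$; a graph is a trigraph with no red edges. $N_G(v)$ is the set of vertices joined to $v$ by a black or red edge. A $d$-trigraph is a trigraph in which every vertex is incident with at most $d$ red edges. A contraction merges two distinct (not necessarily adjacent) vertices $u,v$ into a new vertex $w$: every vertex other than $u,v$ in $N_G(u)\triangle N_G(v)$ is joined to $w$ by a red edge; every $x\in N_G(u)\cap N_G(v)$ is joined to $w$ by a black edge if $ux,vx\in E(G)$ and by a red edge otherwise; all edges not incident with $u$ or $v$ are unchanged, and $u,v$ and their incident edges are removed. A $d$-sequence of an $n$-vertex graph $G$ is a sequence of $d$-trigraphs $G_n=G,G_{n-1},\dots,G_1=K_1$ with each $G_{i-1}$ obtained from $G_i$ by one contraction. The twin-width $\mathrm{tww}(G)$ is the least $d$ such that $G$ admits a $d$-sequence. Tensor product. $G\times H$ has vertex set $V(G)\times V(H)$, and $(u,i)(v,j)$ is an edge iff $uv\in E(G)$ and $ij\in E(H)$. *)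

theory Defs
  imports "Graph_Theory.Pair_Digraph"
begin

text \<open>
  A finite simple graph is a library \<^term>\<open>pair_graph\<close>: finite, loopless and symmetric, an
  undirected edge \<open>uv\<close> being the pair of arcs \<open>(u, v)\<close>, \<open>(v, u)\<close>. Hence the degree of a vertex is
  its \<^term>\<open>out_degree\<close>.
\<close>

text \<open>The supremum is over a finite set of naturals; it is 0 for the graph without vertices.\<close>

definition max_degree :: "'a pair_pre_digraph \<Rightarrow> nat" where
  "max_degree G = (SUP v\<in>pverts G. out_degree (with_proj G) v)"

definition tensor_product ::
    "'a pair_pre_digraph \<Rightarrow> 'b pair_pre_digraph \<Rightarrow> ('a \<times> 'b) pair_pre_digraph"
    (infixl "\<times>\<^sub>t" 70) where
  "G \<times>\<^sub>t H =
    \<lparr> pverts = pverts G \<times> pverts H,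
      parcs = {((u, i), (v, j)) | u i v j. (u, v) \<in> parcs G \<and> (i, j) \<in> parcs H} \<rparr>"

record 'a trigraph =
  tverts :: "'a set"
  black :: "'a rel"
  red :: "'a rel"

abbreviation black_graph :: "'a trigraph \<Rightarrow> 'a pair_pre_digraph" where
  "black_graph T \<equiv> \<lparr> pverts = tverts T, parcs = black T \<rparr>"

abbreviation red_graph :: "'a trigraph \<Rightarrow> 'a pair_pre_digraph" where
  "red_graph T \<equiv> \<lparr> pverts = tverts T, parcs = red T \<rparr>"

definition is_trigraph :: "'a trigraph \<Rightarrow> bool" where
  "is_trigraph T \<longleftrightarrow>
    pair_graph (black_graph T) \<and> pair_graph (red_graph T) \<and> black T \<inter> red T = {}"

definition is_d_trigraph :: "nat \<Rightarrow> 'a trigraph \<Rightarrow> bool" where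
  "is_d_trigraph d T \<longleftrightarrow>
    is_trigraph T \<and> (\<forall>v\<in>tverts T. out_degree (with_proj (red_graph T)) v \<le> d)"

definition trigraph_of :: "'a pair_pre_digraph \<Rightarrow> 'a trigraph" where
  "trigraph_of G = \<lparr> tverts = pverts G, black = parcs G, red = {} \<rparr>"

definition nbrs :: "'a trigraph \<Rightarrow> 'a \<Rightarrow> 'a set" where
  "nbrs T v = {x. (v, x) \<in> black T \<union> red T}"

definition contract :: "'a trigraph \<Rightarrow> 'a \<Rightarrow> 'a \<Rightarrow> 'a \<Rightarrow> 'a trigraph" where
  "contract T u v w =
    (let V = tverts T - {u, v};
         common = nbrs T u \<inter> nbrs T v;
         both_black = {x. (u, x) \<in> black T \<and> (v, x) \<in> black T};
         B = common \<inter> both_black;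
         R = (sym_diff (nbrs T u) (nbrs T v) - {u, v}) \<union> (common - both_black)
     in \<lparr> tverts = insert w V,
          black = (black T \<inter> V \<times> V) \<union> {w} \<times> B \<union> B \<times> {w},
          red = (red T \<inter> V \<times> V) \<union> {w} \<times> R \<union> R \<times> {w} \<rparr>)"

text \<open>
  The merged vertex \<open>w\<close> only has to be new relative to the vertices that remain: it may reuse the
  name \<open>u\<close> or \<open>v\<close>. Up to isomorphism nothing changes, and a contraction is always possible
  even if \<open>tverts T\<close> exhausts the type.
\<close>

definition is_contraction :: "'a trigraph \<Rightarrow> 'a trigraph \<Rightarrow> bool" where
  "is_contraction T T' \<longleftrightarrow>
    (\<exists>u\<in>tverts T. \<exists>v\<in>tverts T. \<exists>w. u \<noteq> v \<and> w \<notin> tverts T - {u, v} \<and> T' = contract T u v w)"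

text \<open>For \<open>n \<ge> 1\<close> only the values \<open>S n, \<dots>, S 1\<close> matter.\<close>

definition is_d_sequence :: "nat \<Rightarrow> 'a pair_pre_digraph \<Rightarrow> (nat \<Rightarrow> 'a trigraph) \<Rightarrow> bool" where
  "is_d_sequence d G S \<longleftrightarrow>
    (let n = card (pverts G) in
      S n = trigraph_of G \<and>
      (\<exists>v. S 1 = \<lparr> tverts = {v}, black = {}, red = {} \<rparr>) \<and>
      (\<forall>i\<in>{1..n}. is_d_trigraph d (S i)) \<and>
      (\<forall>i\<in>{2..n}. is_contraction (S i) (S (i - 1))))"

text \<open>
  The least \<open>d\<close> exists by \<open>d_sequence_exists\<close> below. The graph without vertices, which has no
  contraction sequence in the literal sense, gets twin-width 0 (\<open>tww_empty\<close>).
\<close>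

definition tww :: "'a pair_pre_digraph \<Rightarrow> nat" where
  "tww G = (LEAST d. \<exists>S. is_d_sequence d G S)"

lemma tww_empty:
  assumes "pverts G = {}"
  shows "tww G = 0"
proof -
  have "is_d_sequence 0 G (\<lambda>i. if i = 0 then trigraph_of G
          else \<lparr> tverts = {undefined}, black = {}, red = {} \<rparr>)"
    using assms by (simp add: is_d_sequence_def)
  then show ?thesis unfolding tww_def by (intro Least_eq_0) blast
qed

lemma pair_graph_iff:
  "pair_graph G \<longleftrightarrow>
    finite (pverts G) \<and> parcs G \<subseteq> pverts G \<times> pverts G \<and> sym (parcs G) \<and> irrefl (parcs G)"
proof
  assume "pair_graph G"
  then interpret pair_graph G .
  have "sym (parcs G)" using pair_sym_arcs by (simp add: symmetric_def)
  moreover have "irrefl (parcs G)" using pair_no_loops by (fastforce simp: irrefl_def)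
  ultimately show "finite (pverts G) \<and> parcs G \<subseteq> pverts G \<times> pverts G \<and> sym (parcs G) \<and> irrefl (parcs G)"
    using in_arcsD1 in_arcsD2 pair_finite_verts by auto
next
  assume "finite (pverts G) \<and> parcs G \<subseteq> pverts G \<times> pverts G \<and> sym (parcs G) \<and> irrefl (parcs G)"
  then show "pair_graph G"
    by unfold_locales (auto simp: symmetric_def irrefl_def intro: finite_subset)
qed

lemma is_trigraph_contract:
  assumes "is_trigraph T" "u \<in> tverts T" "v \<in> tverts T" "u \<noteq> v" "w \<notin> tverts T - {u, v}"
  shows "is_trigraph (contract T u v w)"
proof -
  define V where "V = tverts T - {u, v}"
  define B where "B = nbrs T u \<inter> nbrs T v \<inter> {x. (u, x) \<in> black T \<and> (v, x) \<in> black T}"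
  define R where "R = (sym_diff (nbrs T u) (nbrs T v) - {u, v}) \<union>
    (nbrs T u \<inter> nbrs T v - {x. (u, x) \<in> black T \<and> (v, x) \<in> black T})"
  have T: "finite (tverts T)" "black T \<subseteq> tverts T \<times> tverts T" "red T \<subseteq> tverts T \<times> tverts T"
    "sym (black T)" "sym (red T)" "irrefl (black T)" "irrefl (red T)" "black T \<inter> red T = {}"
    using assms(1) by (simp_all add: is_trigraph_def pair_graph_iff)
  have irr: "u \<notin> nbrs T u" "v \<notin> nbrs T v" using T by (auto simp: nbrs_def irrefl_def)
  have sub: "nbrs T u \<subseteq> tverts T" "nbrs T v \<subseteq> tverts T" using T by (auto simp: nbrs_def)
  have "B \<subseteq> V" "R \<subseteq> V" "B \<inter> R = {}" "w \<notin> V" "finite V"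
    using irr sub assms(5) T(1) by (auto simp: B_def R_def V_def)
  moreover have "contract T u v w = \<lparr> tverts = insert w V,
      black = (black T \<inter> V \<times> V) \<union> {w} \<times> B \<union> B \<times> {w},
      red = (red T \<inter> V \<times> V) \<union> {w} \<times> R \<union> R \<times> {w} \<rparr>"
    by (simp add: contract_def Let_def V_def B_def R_def)
  moreover have "is_trigraph \<dots>"
  proof -
    have "sym ((E \<inter> V \<times> V) \<union> {w} \<times> X \<union> X \<times> {w})" if "sym E" for E X
      using that by (auto simp: sym_def)
    moreover have "irrefl ((E \<inter> V \<times> V) \<union> {w} \<times> X \<union> X \<times> {w})" if "irrefl E" "X \<subseteq> V" for E X
      using that \<open>w \<notin> V\<close> by (auto simp: irrefl_def)
    moreover have "((black T \<inter> V \<times> V) \<union> {w} \<times> B \<union> B \<times> {w}) \<inter>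
        ((red T \<inter> V \<times> V) \<union> {w} \<times> R \<union> R \<times> {w}) = {}"
      using T(8) \<open>B \<subseteq> V\<close> \<open>R \<subseteq> V\<close> \<open>B \<inter> R = {}\<close> \<open>w \<notin> V\<close> by blast
    ultimately show ?thesis
      using T(4-7) \<open>B \<subseteq> V\<close> \<open>R \<subseteq> V\<close> \<open>finite V\<close>
      by (auto simp: is_trigraph_def pair_graph_iff)
  qed
  ultimately show ?thesis by simp
qed

lemma d_sequence_exists:
  assumes "pair_graph G"
  shows "\<exists>d S. is_d_sequence d G S"
proof -
  have gen: "\<exists>S. S n = T \<and> (\<exists>v. S 1 = \<lparr> tverts = {v}, black = {}, red = {} \<rparr>) \<and>
      (\<forall>i\<in>{1..n}. is_trigraph (S i)) \<and> (\<forall>i\<in>{2..n}. is_contraction (S i) (S (i - 1)))"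
    if "is_trigraph T" "card (tverts T) = n" "n \<ge> 1" for n and T :: "'a trigraph"
    using that(3,1,2)
  proof (induction n arbitrary: T rule: dec_induct)
    case base
    then obtain v where v: "tverts T = {v}" by (auto simp: card_1_singleton_iff)
    have "black T = {}" "red T = {}"
      using base v by (auto simp: is_trigraph_def pair_graph_iff irrefl_def)
    with v have T: "T = \<lparr> tverts = {v}, black = {}, red = {} \<rparr>" by simp
    show ?case
      by (rule exI[of _ "\<lambda>_. T"]) (use T base in auto)
  next
    case (step n)
    have fin: "finite (tverts T)" using step.prems by (intro card_ge_0_finite) simp
    obtain u v where uv: "u \<in> tverts T" "v \<in> tverts T" "u \<noteq> v"
      using step.prems(2) step.hyps(1) fin
      by (metis card_le_Suc0_iff_eq One_nat_def Suc_le_mono not_less_eq_eq)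
    let ?T = "contract T u v u"
    have tv: "tverts ?T = tverts T - {v}" using uv by (auto simp: contract_def Let_def)
    have "is_trigraph ?T" using is_trigraph_contract[OF step.prems(1) uv] by simp
    moreover have "card (tverts ?T) = n" using tv uv step.prems(2) fin by simp
    ultimately obtain S where S: "S n = ?T" "\<exists>v. S 1 = \<lparr> tverts = {v}, black = {}, red = {} \<rparr>"
      "\<forall>i\<in>{1..n}. is_trigraph (S i)" "\<forall>i\<in>{2..n}. is_contraction (S i) (S (i - 1))"
      using step.IH by blast
    have "is_contraction T ?T" unfolding is_contraction_def using uv by blast
    with S step show ?case
      by (intro exI[of _ "S(Suc n := T)"]) (auto simp: le_Suc_eq)
  qed
  show ?thesis
  proof (cases "pverts G = {}")
    case True
    then have "is_d_sequence 0 G (\<lambda>i. if i = 0 then trigraph_of G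
            else \<lparr> tverts = {undefined}, black = {}, red = {} \<rparr>)"
      by (simp add: is_d_sequence_def)
    then show ?thesis by blast
  next
    case False
    let ?n = "card (pverts G)"
    have n: "?n \<ge> 1" using False assms by (simp add: pair_graph_iff Suc_le_eq card_gt_0_iff)
    have T: "is_trigraph (trigraph_of G)"
      using assms by (auto simp: is_trigraph_def trigraph_of_def pair_graph_iff sym_def irrefl_def)
    obtain S where S: "S ?n = trigraph_of G" "\<exists>v. S 1 = \<lparr> tverts = {v}, black = {}, red = {} \<rparr>"
      "\<forall>i\<in>{1..?n}. is_trigraph (S i)" "\<forall>i\<in>{2..?n}. is_contraction (S i) (S (i - 1))"
      using gen[OF T _ n] by (auto simp: trigraph_of_def)
    define D where "D = (\<Union>i\<in>{1..?n}. (\<lambda>v. out_degree (with_proj (red_graph (S i))) v) ` tverts (S i))"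
    have "finite D" unfolding D_def using S(3) by (auto simp: is_trigraph_def pair_graph_iff)
    then have "out_degree (with_proj (red_graph (S i))) v \<le> Max D"
      if "i \<in> {1..?n}" "v \<in> tverts (S i)" for i v
      using that by (intro Max_ge) (auto simp: D_def)
    then have "is_d_sequence (Max D) G S"
      using S by (simp add: is_d_sequence_def Let_def is_d_trigraph_def)
    then show ?thesis by blast
  qed
qed

end

theory Submission
  imports Defs
begin

text \<open>
  Every trigraph in a contraction sequence of a graph is a quotient of that graph by a labelling
  of its vertices. Contract \<open>G \<times> H\<close> in two phases. First follow an optimal sequence of \<open>G\<close>,
  performing each contraction of \<open>u\<close> and \<open>v\<close> into \<open>w\<close> in one copy \<open>G \<times> {i}\<close> after the other. A part
  in copy \<open>i\<close> has red neighbours only in the at most \<open>\<Delta>(H)\<close> copies \<open>j\<close> adjacent to \<open>i\<close>, and at most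
  \<open>tww(G) + 2\<close> in each: those inherited from \<open>G\<close>, and either its own counterpart and \<open>w\<close>, or \<open>u\<close>
  and \<open>v\<close>. Once each copy is a single vertex, follow an optimal sequence of \<open>H\<close>. Now black edges of
  the quotient of \<open>H\<close> may have become red, but a part has at most \<open>\<Delta>(H)\<close> of them, since each
  accounts for a different neighbour of any chosen vertex of the part.
\<close>

section \<open>Quotients of a graph by vertex labellings\<close>

definition touch :: "'a pair_pre_digraph \<Rightarrow> ('a \<Rightarrow> 'c) \<Rightarrow> ('a \<Rightarrow> 'd) \<Rightarrow> ('c \<times> 'd) set" where
  "touch G h k = map_prod h k ` parcs G"

definition miss :: "'a pair_pre_digraph \<Rightarrow> ('a \<Rightarrow> 'c) \<Rightarrow> ('a \<Rightarrow> 'd) \<Rightarrow> ('c \<times> 'd) set" where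
  "miss G h k = map_prod h k ` (pverts G \<times> pverts G - parcs G)"

text \<open>These are the inhomogeneous pairs of fibres, the source of red edges. The two sides have
  separate labellings because adjacent copies of \<open>G\<close> in the product may be at different
  stages of contraction.\<close>

definition mixed :: "'a pair_pre_digraph \<Rightarrow> ('a \<Rightarrow> 'c) \<Rightarrow> ('a \<Rightarrow> 'd) \<Rightarrow> ('c \<times> 'd) set" where
  "mixed G h k = touch G h k \<inter> miss G h k"

text \<open>
  For loopless \<open>G\<close> the black relation is irreflexive as it stands, whereas \<open>mixed\<close> relates a
  label to itself as soon as its fibre spans an edge.
\<close>

definition quotient_trigraph :: "'a pair_pre_digraph \<Rightarrow> ('a \<Rightarrow> 'c) \<Rightarrow> 'c trigraph" where
  "quotient_trigraph G f =
    \<lparr> tverts = f ` pverts G, black = touch G f f - miss G f f, red = mixed G f f - Id \<rparr>"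

definition merge :: "'c \<Rightarrow> 'c \<Rightarrow> 'c \<Rightarrow> 'c \<Rightarrow> 'c" where
  "merge u v w a = (if a = u \<or> a = v then w else a)"

definition mergeable :: "'c set \<Rightarrow> 'c \<Rightarrow> 'c \<Rightarrow> 'c \<Rightarrow> bool" where
  "mergeable L u v w \<longleftrightarrow> u \<in> L \<and> v \<in> L \<and> u \<noteq> v \<and> w \<notin> L - {u, v}"

text \<open>The degree half of \<open>is_d_trigraph\<close>; the other half is automatic for
  quotients of simple graphs, by \<open>is_trigraph_quotient\<close>.\<close>

definition red_bounded :: "nat \<Rightarrow> 'c trigraph \<Rightarrow> bool" where
  "red_bounded d T \<longleftrightarrow> (\<forall>a\<in>tverts T. card (red T `` {a}) \<le> d)"

text \<open>Only the target carries a degree bound, so steps chain freely; the bound for the first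
  trigraph is supplied once, in \<open>tww_le_if_contracts_to\<close>.\<close>

definition contracts_to :: "nat \<Rightarrow> 'c trigraph \<Rightarrow> 'c trigraph \<Rightarrow> bool" where
  "contracts_to d T T' \<longleftrightarrow> is_contraction T T' \<and> is_d_trigraph d T'"

lemma out_degree_with_proj: "out_degree (with_proj G) v = card (parcs G `` {v})"
proof -
  have "out_arcs (with_proj G) v = Pair v ` (parcs G `` {v})"
    by (auto simp: out_arcs_def)
  then show ?thesis by (simp add: out_degree_def card_image inj_on_def)
qed

lemma is_d_trigraph_iff: "is_d_trigraph d T \<longleftrightarrow> is_trigraph T \<and> red_bounded d T"
  by (simp add: is_d_trigraph_def red_bounded_def out_degree_with_proj)

lemma card_nbrs_le_max_degree:
  assumes "finite (pverts H)" "i \<in> pverts H"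
  shows "card (parcs H `` {i}) \<le> max_degree H"
  unfolding max_degree_def out_degree_with_proj[symmetric]
  using assms by (intro cSUP_upper) auto

lemma pair_graph_tensor_product:
  assumes "pair_graph G" "pair_graph H"
  shows "pair_graph (G \<times>\<^sub>t H)"
  using assms unfolding pair_graph_iff tensor_product_def
  by (auto simp: sym_def irrefl_def)

text \<open>Any two vertices are joined or not. So for a single labelling a pair of labels in use
  lies in \<open>touch\<close> alone (black), in \<open>miss\<close> alone (no edge) or in both (red
  off the diagonal).\<close>

lemma touch_Un_miss:
  assumes "pair_graph G"
  shows "touch G h k \<union> miss G h k = h ` pverts G \<times> k ` pverts G"
proof -
  have "parcs G \<union> (pverts G \<times> pverts G - parcs G) = pverts G \<times> pverts G"
    using assms by (auto simp: pair_graph_iff)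
  then show ?thesis
    by (simp add: touch_def miss_def map_prod_surj_on[OF refl refl] flip: image_Un)
qed

lemma quotient_trigraph_cong:
  assumes "pair_graph G" "\<And>x. x \<in> pverts G \<Longrightarrow> f x = g x"
  shows "quotient_trigraph G f = quotient_trigraph G g"
proof -
  have "parcs G \<subseteq> pverts G \<times> pverts G" using assms(1) by (simp add: pair_graph_iff)
  then have "touch G f f = touch G g g" "miss G f f = miss G g g"
    unfolding touch_def miss_def using assms(2) by (auto intro!: image_cong)
  then show ?thesis
    using assms(2) by (simp add: quotient_trigraph_def mixed_def cong: image_cong_simp)
qed

lemma trigraph_of_eq_quotient:
  assumes "pair_graph G"
  shows "trigraph_of G = quotient_trigraph G id"
  using assms
  by (auto simp: trigraph_of_def quotient_trigraph_def mixed_def touch_def miss_def prod.map_id0)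

lemma miss_refl: "pair_graph G \<Longrightarrow> a \<in> f ` pverts G \<Longrightarrow> (a, a) \<in> miss G f f"
  by (force simp: miss_def pair_graph_iff irrefl_def)

lemma sym_touch: "pair_graph G \<Longrightarrow> sym (touch G f f)"
  by (force simp: touch_def sym_def pair_graph_iff image_iff)

lemma sym_miss: "pair_graph G \<Longrightarrow> sym (miss G f f)"
  by (force simp: miss_def sym_def pair_graph_iff image_iff)

lemma is_trigraph_quotient:
  assumes "pair_graph G"
  shows "is_trigraph (quotient_trigraph G f)"
  unfolding is_trigraph_def pair_graph_iff quotient_trigraph_def mixed_def
  using touch_Un_miss[OF assms, of f f] miss_refl[OF assms, of _ f]
    sym_touch[OF assms, of f] sym_miss[OF assms, of f] assms
  by (auto simp: sym_def irrefl_def pair_graph_iff)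

section \<open>Contraction as merging of two labels\<close>

lemma touch_comp_left: "(a, b) \<in> touch G (m \<circ> h) k \<longleftrightarrow> (\<exists>a'. (a', b) \<in> touch G h k \<and> a = m a')"
  by (force simp: touch_def image_iff)

lemma touch_comp_right: "(a, b) \<in> touch G h (m \<circ> k) \<longleftrightarrow> (\<exists>b'. (a, b') \<in> touch G h k \<and> b = m b')"
  by (force simp: touch_def image_iff)

lemma miss_comp_left: "(a, b) \<in> miss G (m \<circ> h) k \<longleftrightarrow> (\<exists>a'. (a', b) \<in> miss G h k \<and> a = m a')"
  by (force simp: miss_def image_iff)

lemma miss_comp_right: "(a, b) \<in> miss G h (m \<circ> k) \<longleftrightarrow> (\<exists>b'. (a, b') \<in> miss G h k \<and> b = m b')"
  by (force simp: miss_def image_iff)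

text \<open>The new fibre of \<open>w\<close> is the union of the fibres of \<open>u\<close> and
  \<open>v\<close>. It touches another fibre iff one of the two does, and likewise for missing.
  Hence it misses nothing of that fibre exactly when both edges were black, which is the rule for
  black edges in \<open>contract\<close>.\<close>

lemma contract_quotient:
  assumes G: "pair_graph G" and m: "mergeable (f ` pverts G) u v w"
  shows "contract (quotient_trigraph G f) u v w = quotient_trigraph G (merge u v w \<circ> f)"
proof -
  let ?g = "merge u v w \<circ> f" and ?L = "f ` pverts G"
  have uv: "u \<in> ?L" "v \<in> ?L" "u \<noteq> v" "w \<notin> ?L - {u, v}"
    using m by (auto simp: mergeable_def)
  have un: "(a, b) \<in> touch G f f \<or> (a, b) \<in> miss G f f \<longleftrightarrow> a \<in> ?L \<and> b \<in> ?L" for a b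
    using touch_Un_miss[OF G, of f f] by blast
  have s: "(a, b) \<in> touch G f f \<longleftrightarrow> (b, a) \<in> touch G f f"
    "(a, b) \<in> miss G f f \<longleftrightarrow> (b, a) \<in> miss G f f" for a b
    using sym_touch[OF G, of f] sym_miss[OF G, of f] by (auto simp: sym_def)
  have r: "(a, a) \<in> miss G f f" if "a \<in> ?L" for a using miss_refl[OF G that] .
  have tg: "(a, b) \<in> touch G ?g ?g \<longleftrightarrow>
    (\<exists>a' b'. (a', b') \<in> touch G f f \<and> a = merge u v w a' \<and> b = merge u v w b')" for a b
    by (auto simp: touch_comp_left touch_comp_right)
  have mg: "(a, b) \<in> miss G ?g ?g \<longleftrightarrow>
    (\<exists>a' b'. (a', b') \<in> miss G f f \<and> a = merge u v w a' \<and> b = merge u v w b')" for a b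
    by (auto simp: miss_comp_left miss_comp_right)
  have ung: "(a, b) \<in> touch G ?g ?g \<or> (a, b) \<in> miss G ?g ?g \<longleftrightarrow> a \<in> ?g ` pverts G \<and> b \<in> ?g ` pverts G"
    for a b using touch_Un_miss[OF G, of ?g ?g] by blast
  have V: "?g ` pverts G = insert w (?L - {u, v})"
    using uv by (auto simp: merge_def image_iff)
  define V' where "V' = ?L - {u, v}"
  have w: "w \<notin> V'" using uv by (simp add: V'_def)
  \<comment> \<open>Freshness of \<open>w\<close> enters here: a surviving label has only itself as
    preimage, and \<open>w\<close> has exactly \<open>u\<close> and \<open>v\<close>.\<close>
  have merge_eq: "a = merge u v w a' \<longleftrightarrow> a = a'" if "a \<in> V'" "a' \<in> ?L" for a a'
    using that w by (auto simp: merge_def V'_def)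
  have merge_w: "w = merge u v w a' \<longleftrightarrow> a' = u \<or> a' = v" if "a' \<in> ?L" for a'
    using that w by (auto simp: merge_def V'_def)
  have gVV: "(a, b) \<in> touch G ?g ?g \<longleftrightarrow> (a, b) \<in> touch G f f"
    "(a, b) \<in> miss G ?g ?g \<longleftrightarrow> (a, b) \<in> miss G f f" if "a \<in> V'" "b \<in> V'" for a b
    unfolding tg mg using that un merge_eq by metis+
  have gwV: "(w, b) \<in> touch G ?g ?g \<longleftrightarrow> (u, b) \<in> touch G f f \<or> (v, b) \<in> touch G f f"
    "(w, b) \<in> miss G ?g ?g \<longleftrightarrow> (u, b) \<in> miss G f f \<or> (v, b) \<in> miss G f f" if "b \<in> V'" for b
    unfolding tg mg using that un merge_eq merge_w by metis+
  have gs: "(a, b) \<in> touch G ?g ?g \<longleftrightarrow> (b, a) \<in> touch G ?g ?g"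
    "(a, b) \<in> miss G ?g ?g \<longleftrightarrow> (b, a) \<in> miss G ?g ?g" for a b
    using sym_touch[OF G, of ?g] sym_miss[OF G, of ?g] by (auto simp: sym_def)
  \<comment> \<open>The fibre of \<open>w\<close> may span an edge; this excludes a black loop at
    \<open>w\<close>, while a red one is removed with \<open>Id\<close>.\<close>
  have gr: "(w, w) \<in> miss G ?g ?g" using miss_refl[OF G, of w ?g] V by blast
  let ?T = "quotient_trigraph G f"
  define B where "B = nbrs ?T u \<inter> nbrs ?T v \<inter> {x. (u, x) \<in> black ?T \<and> (v, x) \<in> black ?T}"
  define R where "R = (sym_diff (nbrs ?T u) (nbrs ?T v) - {u, v}) \<union>
    (nbrs ?T u \<inter> nbrs ?T v - {x. (u, x) \<in> black ?T \<and> (v, x) \<in> black ?T})"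
  have B: "x \<in> B \<longleftrightarrow> x \<in> V' \<and> (w, x) \<in> touch G ?g ?g - miss G ?g ?g" for x
  proof (cases "x \<in> V'")
    case True
    then have "x \<in> ?L" by (simp add: V'_def)
    then show ?thesis using gwV[OF True] un[of u x] un[of v x] uv True
      by (auto simp: B_def quotient_trigraph_def mixed_def nbrs_def)
  next
    case False
    then show ?thesis using un r uv
      by (auto simp: B_def quotient_trigraph_def mixed_def nbrs_def V'_def)
  qed
  have R: "x \<in> R \<longleftrightarrow> x \<in> V' \<and> (w, x) \<in> mixed G ?g ?g" for x
  proof (cases "x \<in> V'")
    case True
    then have "x \<in> ?L" "x \<noteq> u" "x \<noteq> v" by (auto simp: V'_def)
    then show ?thesis using gwV[OF True] un[of u x] un[of v x] uv True
      by (auto simp: R_def quotient_trigraph_def mixed_def nbrs_def)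
  next
    case False
    then show ?thesis using un r uv
      by (auto simp: R_def quotient_trigraph_def mixed_def nbrs_def V'_def)
  qed
  have c: "contract ?T u v w = \<lparr> tverts = insert w V',
      black = (black ?T \<inter> V' \<times> V') \<union> {w} \<times> B \<union> B \<times> {w},
      red = (red ?T \<inter> V' \<times> V') \<union> {w} \<times> R \<union> R \<times> {w} \<rparr>"
    by (simp add: contract_def Let_def V'_def B_def R_def) (simp add: quotient_trigraph_def)
  have "(a, b) \<in> black (contract ?T u v w) \<longleftrightarrow> (a, b) \<in> touch G ?g ?g - miss G ?g ?g" for a b
  proof (cases "a \<in> insert w V' \<and> b \<in> insert w V'")
    case True
    then show ?thesis using gVV[of a b] w gr gs[of a b] unfolding c
      by (auto simp: B quotient_trigraph_def)
  next
    case False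
    then show ?thesis using ung[of a b] unfolding c V
      by (auto simp: B V'_def)
  qed
  moreover have "(a, b) \<in> red (contract ?T u v w) \<longleftrightarrow> (a, b) \<in> mixed G ?g ?g - Id" for a b
  proof (cases "a \<in> insert w V' \<and> b \<in> insert w V'")
    case True
    then show ?thesis using gVV[of a b] w gs[of a b] unfolding c
      by (auto simp: R quotient_trigraph_def mixed_def)
  next
    case False
    then show ?thesis using ung[of a b] unfolding c V
      by (auto simp: R V'_def mixed_def)
  qed
  ultimately have "black (contract ?T u v w) = black (quotient_trigraph G ?g)"
    "red (contract ?T u v w) = red (quotient_trigraph G ?g)"
    by (auto simp: quotient_trigraph_def)
  moreover have "tverts (contract ?T u v w) = tverts (quotient_trigraph G ?g)"
    unfolding c using V by (simp add: quotient_trigraph_def V'_def)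
  ultimately show ?thesis by simp
qed

section \<open>Contraction sequences as chains of label merges\<close>

lemma contracts_to_quotient:
  assumes "pair_graph G" "mergeable (f ` pverts G) u v w"
    and "red_bounded d (quotient_trigraph G (merge u v w \<circ> f))"
  shows "contracts_to d (quotient_trigraph G f) (quotient_trigraph G (merge u v w \<circ> f))"
proof -
  have "is_contraction (quotient_trigraph G f) (contract (quotient_trigraph G f) u v w)"
    using assms(2) unfolding is_contraction_def mergeable_def
    by (auto simp only: quotient_trigraph_def trigraph.select_convs)
  then show ?thesis
    using assms is_trigraph_quotient[OF assms(1)] contract_quotient[OF assms(1,2)]
    by (simp add: contracts_to_def is_d_trigraph_iff)
qed

text \<open>A contraction lowers the number of vertices by exactly one, so each trigraph of the
  chain can be stored at the index given by its number of vertices.\<close>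

lemma contraction_sequence_if_contracts_to:
  assumes "(contracts_to d)\<^sup>*\<^sup>* T T'" "is_d_trigraph d T" "card (tverts T') = 1"
  shows "\<exists>S. S (card (tverts T)) = T \<and> S 1 = T' \<and> card (tverts T) \<ge> 1 \<and>
    (\<forall>i\<in>{1..card (tverts T)}. is_d_trigraph d (S i)) \<and>
    (\<forall>i\<in>{2..card (tverts T)}. is_contraction (S i) (S (i - 1)))"
  using assms
proof (induction rule: converse_rtranclp_induct)
  case base
  then show ?case by (intro exI[of _ "\<lambda>_. T'"]) auto
next
  case (step T T2)
  then obtain S where S: "S (card (tverts T2)) = T2" "S 1 = T'" "card (tverts T2) \<ge> 1"
    "\<forall>i\<in>{1..card (tverts T2)}. is_d_trigraph d (S i)"
    "\<forall>i\<in>{2..card (tverts T2)}. is_contraction (S i) (S (i - 1))"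
    by (auto simp: contracts_to_def)
  obtain u v w where uvw: "u \<in> tverts T" "v \<in> tverts T" "u \<noteq> v" "w \<notin> tverts T - {u, v}"
    "T2 = contract T u v w"
    using step.hyps(1) by (auto simp: contracts_to_def is_contraction_def)
  have fin: "finite (tverts T)"
    using step.prems(1) by (simp add: is_d_trigraph_iff is_trigraph_def pair_graph_iff)
  have "tverts T2 = insert w (tverts T - {u, v})"
    using uvw by (simp add: contract_def Let_def)
  then have "card (tverts T2) = Suc (card (tverts T - {u, v}))"
    using fin uvw(4) by simp
  moreover have "card (tverts T) = card (tverts T - {u, v}) + card {u, v}"
    using fin uvw by (metis card_Diff_subset card_mono empty_subsetI finite.emptyI finite_insert
        insert_subset le_add_diff_inverse2)
  ultimately have card: "card (tverts T) = Suc (card (tverts T2))"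
    using uvw(3) by simp
  have "is_contraction T T2" using step.hyps(1) by (simp add: contracts_to_def)
  with S card step.prems show ?case
    by (intro exI[of _ "S(card (tverts T) := T)"]) (auto simp: le_Suc_eq)
qed

lemma tww_le_if_contracts_to:
  assumes G: "pair_graph G"
    and "(contracts_to d)\<^sup>*\<^sup>* (quotient_trigraph G id) (quotient_trigraph G f)"
    and c: "f ` pverts G = {c}"
  shows "tww G \<le> d"
proof -
  have tv: "tverts (quotient_trigraph G f) = {c}" using c by (simp add: quotient_trigraph_def)
  have "is_d_trigraph d (quotient_trigraph G id)"
    using is_trigraph_quotient[OF G, of id]
    by (simp add: is_d_trigraph_iff red_bounded_def flip: trigraph_of_eq_quotient[OF G])
      (simp add: trigraph_of_def)
  moreover have "card (tverts (quotient_trigraph G id)) = card (pverts G)"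
    by (simp add: quotient_trigraph_def)
  ultimately obtain S where S: "S (card (pverts G)) = trigraph_of G" "S 1 = quotient_trigraph G f"
    "\<forall>i\<in>{1..card (pverts G)}. is_d_trigraph d (S i)"
    "\<forall>i\<in>{2..card (pverts G)}. is_contraction (S i) (S (i - 1))"
    using contraction_sequence_if_contracts_to[OF assms(2)] tv
    by (auto simp: trigraph_of_eq_quotient[OF G])
  have "black (quotient_trigraph G f) = {}" "red (quotient_trigraph G f) = {}"
    using is_trigraph_quotient[OF G, of f] tv
    by (auto simp: is_trigraph_def pair_graph_iff irrefl_def)
  then have "S 1 = \<lparr> tverts = {c}, black = {}, red = {} \<rparr>"
    using S(2) tv by simp
  then have "is_d_sequence d G S" using S(1,3,4) unfolding is_d_sequence_def Let_def by blast
  then show ?thesis unfolding tww_def by (intro Least_le) blast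
qed

text \<open>An optimal sequence of \<open>G\<close> becomes a chain of labellings from
  \<open>id\<close> to a constant one, along which an invariant can be carried without indices. The
  step offers the degree bounds both before and after the merge, since phase one uses both
  labellings at once.\<close>

lemma tww_induct:
  assumes G: "pair_graph G" and "pverts G \<noteq> {}" and "Q id"
    and step: "\<And>f u v w. \<lbrakk>Q f; mergeable (f ` pverts G) u v w;
      red_bounded (tww G) (quotient_trigraph G f);
      red_bounded (tww G) (quotient_trigraph G (merge u v w \<circ> f))\<rbrakk> \<Longrightarrow> Q (merge u v w \<circ> f)"
  obtains f c where "Q f" "f ` pverts G = {c}"
proof -
  let ?n = "card (pverts G)"
  have "\<exists>S. is_d_sequence (tww G) G S"
    unfolding tww_def by (rule LeastI_ex) (rule d_sequence_exists[OF G])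
  then obtain S where S: "S ?n = trigraph_of G" "\<exists>v. S 1 = \<lparr> tverts = {v}, black = {}, red = {} \<rparr>"
    "\<And>i. 1 \<le> i \<Longrightarrow> i \<le> ?n \<Longrightarrow> is_d_trigraph (tww G) (S i)"
    "\<And>i. 2 \<le> i \<Longrightarrow> i \<le> ?n \<Longrightarrow> is_contraction (S i) (S (i - 1))"
    by (auto simp: is_d_sequence_def Let_def)
  have n: "?n \<ge> 1" using assms(2) G by (simp add: pair_graph_iff Suc_le_eq card_gt_0_iff)
  have "\<exists>f. S 1 = quotient_trigraph G f \<and> Q f"
    using n
  \<comment> \<open>Sequences are numbered by size, so the induction runs from \<open>?n\<close>
    down to 1.\<close>
  proof (induction rule: inc_induct)
    case base
    then show ?case using S(1) trigraph_of_eq_quotient[OF G] \<open>Q id\<close> by auto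
  next
    case (step i)
    then obtain f where f: "S (Suc i) = quotient_trigraph G f" "Q f" by blast
    have "is_contraction (S (Suc i)) (S i)" using S(4)[of "Suc i"] step.hyps by simp
    then obtain u v w where m: "mergeable (f ` pverts G) u v w"
      and "S i = contract (quotient_trigraph G f) u v w"
      by (auto simp: is_contraction_def mergeable_def f(1)) (auto simp: quotient_trigraph_def)
    then have Si: "S i = quotient_trigraph G (merge u v w \<circ> f)"
      using contract_quotient[OF G] by simp
    have "red_bounded (tww G) (S (Suc i))" "red_bounded (tww G) (S i)"
      using S(3) step.hyps by (simp_all add: is_d_trigraph_iff)
    then show ?case using assms(4)[OF f(2) m] Si f(1) by auto
  qed
  then obtain f where "S 1 = quotient_trigraph G f" "Q f" by blast
  with S(2) that show thesis by (auto simp: quotient_trigraph_def)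
qed

section \<open>Phase one: red degrees while the copies of \<open>G\<close> are contracted\<close>

lemma finite_mixed_Image: "pair_graph G \<Longrightarrow> finite (mixed G h k `` {a})"
  by (rule finite_subset[of _ "k ` pverts G"]) (auto simp: mixed_def miss_def pair_graph_iff)

text \<open>
  The cases \<open>h \<noteq> k\<close> compare a copy of \<open>G\<close> in which \<open>u\<close> and \<open>v\<close> are already merged with one in
  which they are not.
\<close>

lemma card_mixed_merge:
  fixes f g h k :: "'a \<Rightarrow> 'c"
  assumes G: "pair_graph G" and m: "mergeable (f ` pverts G) u v w"
    and g: "g = merge u v w \<circ> f"
    and bf: "red_bounded t (quotient_trigraph G f)" and bg: "red_bounded t (quotient_trigraph G g)"
    and hk: "h \<in> {f, g}" "k \<in> {f, g}" and a: "a \<in> h ` pverts G"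
  shows "card (mixed G h k `` {a}) \<le> t + 2"
proof -
  let ?red = "\<lambda>f. red (quotient_trigraph G f)"
  have fin: "finite (mixed G h k `` {a})" for h k :: "'a \<Rightarrow> 'c" and a
    using G by (rule finite_mixed_Image)
  have finr: "finite (?red h `` {a})" for h :: "'a \<Rightarrow> 'c" and a
    by (rule finite_subset[OF _ fin[of h h a]]) (auto simp: quotient_trigraph_def)
  have self: "mixed G h h `` {a} \<subseteq> insert a (?red h `` {a})" for h :: "'a \<Rightarrow> 'c" and a
    by (auto simp: quotient_trigraph_def)
  have rf: "card (?red f `` {b}) \<le> t" if "b \<in> f ` pverts G" for b
    using bf that by (auto simp: red_bounded_def quotient_trigraph_def)
  have rg: "card (?red g `` {b}) \<le> t" if "b \<in> g ` pverts G" for b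
    using bg that by (auto simp: red_bounded_def quotient_trigraph_def)
  \<comment> \<open>\<open>b\<close> and \<open>c\<close> are the two exceptional neighbours; they
    may coincide, and below \<open>a\<close> fills a spare place.\<close>
  have bound: "card (mixed G h k `` {a}) \<le> t + 2"
    if "mixed G h k `` {a} \<subseteq> insert b (insert c X)" "finite X" "card X \<le> t" for b c X
    using card_mono[OF _ that(1)] that(2,3) card_insert_if[of X c] card_insert_if[of "insert c X" b] by (auto split: if_splits)
  consider "h = f" "k = f" | "h = g" "k = g" | "h = f" "k = g" | "h = g" "k = f" using hk by blast
  then show ?thesis
  proof cases
    case 1
    show ?thesis using bound[of a a "?red f `` {a}"] self[of f a] finr rf a 1 by auto
  next
    case 2
    show ?thesis using bound[of a a "?red g `` {a}"] self[of g a] finr rg a 2 by auto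
  next
    case 3
    \<comment> \<open>Every label other than \<open>w\<close> has the same fibre under
      \<open>g\<close> as under \<open>f\<close>, so \<open>w\<close> is the only possible new
      neighbour; \<open>a\<close> itself is the other exception.\<close>
    have "mixed G f g `` {a} \<subseteq> insert w (mixed G f f `` {a})"
      unfolding g mixed_def
      by (auto simp: touch_comp_right miss_comp_right merge_def split: if_splits)
    then show ?thesis using bound[of w a "?red f `` {a}"] self[of f a] finr rf a 3 by auto
  next
    case 4
    show ?thesis
    proof (cases "a = w")
      case True
      \<comment> \<open>This keeps the bound at \<open>t + 2\<close> rather than
        \<open>t + 3\<close>: the own counterpart \<open>w\<close> allowed by \<open>self\<close>
        does not occur in a copy labelled by \<open>f\<close>, unless as \<open>u\<close> or
        \<open>v\<close>.\<close>
      have "w \<notin> mixed G g f `` {a} - {u, v}"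
        using m by (auto simp: mergeable_def mixed_def miss_def)
      moreover have "mixed G g f `` {a} - {u, v} \<subseteq> mixed G g g `` {a}"
      proof
        fix b assume "b \<in> mixed G g f `` {a} - {u, v}"
        then have "(a, b) \<in> touch G g f" "(a, b) \<in> miss G g f" "b = merge u v w b"
          by (auto simp: mixed_def merge_def)
        then show "b \<in> mixed G g g `` {a}"
          unfolding mixed_def using g by (metis IntI ImageI singletonI touch_comp_right miss_comp_right)
      qed
      ultimately have "mixed G g f `` {a} \<subseteq> insert u (insert v (?red g `` {a}))"
        using self[of g a] True by blast
      then show ?thesis using bound[of u v "?red g `` {a}"] finr rg a 4 by auto
    next
      case False
      \<comment> \<open>A label other than \<open>w\<close> that survives the merge keeps its fibre,
        so \<open>a\<close> can be viewed in \<open>f\<close>.\<close>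
      then have "mixed G g f `` {a} \<subseteq> mixed G f f `` {a}"
        unfolding g mixed_def
        by (auto simp: touch_comp_left miss_comp_left merge_def split: if_splits)
      moreover have "a \<in> f ` pverts G" using a False 4 by (auto simp: g merge_def)
      ultimately show ?thesis using bound[of a a "?red f `` {a}"] self[of f a] finr rf 4 by auto
    qed
  qed
qed

text \<open>A red edge between copies \<open>i\<close> and \<open>j\<close> needs an edge of the
  product, so \<open>j\<close> is a neighbour of \<open>i\<close>. Once \<open>ij\<close> is an
  edge, adjacency between these copies is adjacency in \<open>G\<close>, so each neighbouring copy
  contributes at most \<open>c\<close>.\<close>

lemma red_bounded_tensor:
  assumes G: "pair_graph G" and H: "pair_graph H"
    and c: "\<And>i j a. (i, j) \<in> parcs H \<Longrightarrow> a \<in> k i ` pverts G \<Longrightarrow> card (mixed G (k i) (k j) `` {a}) \<le> c"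
  shows "red_bounded (c * max_degree H) (quotient_trigraph (G \<times>\<^sub>t H) (\<lambda>(x, j). (k j x, j)))"
  unfolding red_bounded_def
proof
  let ?T = "quotient_trigraph (G \<times>\<^sub>t H) (\<lambda>(x, j). (k j x, j))"
  fix l assume "l \<in> tverts ?T"
  then obtain a i where l: "l = (a, i)" "i \<in> pverts H" "a \<in> k i ` pverts G"
    by (auto simp: quotient_trigraph_def tensor_product_def)
  let ?N = "parcs H `` {i}"
  have finV: "finite (pverts G)" "finite (pverts H)" "parcs H \<subseteq> pverts H \<times> pverts H"
    using G H by (auto simp: pair_graph_iff)
  have finN: "finite ?N" by (rule finite_subset[OF _ finV(2)]) (use finV(3) in auto)
  have sub: "red ?T `` {l} \<subseteq> (\<Union>j\<in>?N. (\<lambda>b. (b, j)) ` (mixed G (k i) (k j) `` {a}))"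
    by (auto simp: l(1) quotient_trigraph_def mixed_def touch_def miss_def tensor_product_def image_iff)
      force+
  have "card (red ?T `` {l}) \<le> (\<Sum>j\<in>?N. card ((\<lambda>b. (b, j)) ` (mixed G (k i) (k j) `` {a})))"
    by (rule order_trans[OF card_mono[OF _ sub] card_UN_le])
      (use finN finite_mixed_Image[OF G] in \<open>auto intro!: finite_UN_I finite_imageI\<close>)
  also have "\<dots> \<le> (\<Sum>j\<in>?N. c)"
    using c l(3) by (intro sum_mono) (auto simp: card_image inj_on_def)
  also have "\<dots> = c * card ?N" by simp
  also have "\<dots> \<le> c * max_degree H"
    using card_nbrs_le_max_degree[OF finV(2) l(2)] by simp
  finally show "card (red ?T `` {l}) \<le> c * max_degree H" .
qed

lemma red_bounded_mono: "red_bounded c T \<Longrightarrow> c \<le> d \<Longrightarrow> red_bounded d T"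
  by (fastforce simp: red_bounded_def)

lemma contracts_to_merge_copies:
  assumes G: "pair_graph G" and H: "pair_graph H"
    and m: "mergeable (f ` pverts G) u v w" and g: "g = merge u v w \<circ> f"
    and bf: "red_bounded t (quotient_trigraph G f)" and bg: "red_bounded t (quotient_trigraph G g)"
    and d: "(t + 2) * max_degree H \<le> d"
  shows "(contracts_to d)\<^sup>*\<^sup>* (quotient_trigraph (G \<times>\<^sub>t H) (map_prod f id))
    (quotient_trigraph (G \<times>\<^sub>t H) (map_prod g id))"
proof -
  let ?P = "G \<times>\<^sub>t H"
  have P: "pair_graph ?P" using G H by (rule pair_graph_tensor_product)
  \<comment> \<open>\<open>J\<close> is the set of copies in which \<open>u\<close> and
    \<open>v\<close> are already merged; each contraction adds one copy.\<close>
  let ?F = "\<lambda>J (x, j). (if j \<in> J then g x else f x, j)"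
  have "(contracts_to d)\<^sup>*\<^sup>* (quotient_trigraph ?P (?F {})) (quotient_trigraph ?P (?F J))"
    if "finite J" "J \<subseteq> pverts H" for J
    using that
  proof (induction J rule: finite_induct)
    case empty
    show ?case by simp
  next
    case (insert j J)
    let ?m = "merge (u, j) (v, j) (w, j)"
    have F: "?F (insert j J) = ?m \<circ> ?F J"
      using insert.hyps by (auto simp: fun_eq_iff merge_def g)
    have L: "?F J ` pverts ?P = (\<Union>i\<in>pverts H. (if i \<in> J then g else f) ` pverts G \<times> {i})"
      by (auto simp: tensor_product_def image_iff split: if_splits)
    \<comment> \<open>Copy \<open>j\<close> is still labelled by \<open>f\<close>, so freshness of
      \<open>w\<close> carries over.\<close>
    have "mergeable (?F J ` pverts ?P) (u, j) (v, j) (w, j)"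
      using m insert unfolding L by (auto simp: mergeable_def)
    moreover have "red_bounded ((t + 2) * max_degree H)
      (quotient_trigraph ?P (\<lambda>(x, i). ((if i \<in> insert j J then g else f) x, i)))"
      by (rule red_bounded_tensor[OF G H card_mixed_merge[OF G m g bf bg]]) auto
    then have "red_bounded d (quotient_trigraph ?P (?m \<circ> ?F J))"
      unfolding F[symmetric] using d by (elim red_bounded_mono[rotated]) (simp add: if_distribR)
    ultimately have "contracts_to d (quotient_trigraph ?P (?F J)) (quotient_trigraph ?P (?F (insert j J)))"
      unfolding F by (rule contracts_to_quotient[OF P])
    with insert show ?case by auto
  qed
  from this[of "pverts H"] have "(contracts_to d)\<^sup>*\<^sup>* (quotient_trigraph ?P (?F {}))
    (quotient_trigraph ?P (?F (pverts H)))"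
    using H by (simp add: pair_graph_iff)
  moreover have "quotient_trigraph ?P (?F {}) = quotient_trigraph ?P (map_prod f id)"
    by (rule quotient_trigraph_cong[OF P]) auto
  moreover have "quotient_trigraph ?P (?F (pverts H)) = quotient_trigraph ?P (map_prod g id)"
    by (rule quotient_trigraph_cong[OF P]) (auto simp: tensor_product_def)
  ultimately show ?thesis by simp
qed

section \<open>Phase two: red degrees once every copy of \<open>G\<close> is a single vertex\<close>

lemma red_bounded_tensor_collapsed:
  assumes H: "pair_graph H" and b: "red_bounded s (quotient_trigraph H h)"
  shows "red_bounded (s + max_degree H) (quotient_trigraph (G \<times>\<^sub>t H) (map_prod (\<lambda>_. c) h))"
  unfolding red_bounded_def
proof
  let ?T = "quotient_trigraph (G \<times>\<^sub>t H) (map_prod (\<lambda>_. c) h)"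
  fix l assume "l \<in> tverts ?T"
  then obtain i where i: "l = (c, h i)" "i \<in> pverts H"
    by (auto simp: quotient_trigraph_def tensor_product_def)
  let ?R = "red (quotient_trigraph H h) `` {h i}" and ?N = "parcs H `` {i}"
  have finV: "finite (pverts H)" "parcs H \<subseteq> pverts H \<times> pverts H"
    using H by (auto simp: pair_graph_iff)
  have finN: "finite ?N" by (rule finite_subset[OF _ finV(1)]) (use finV(2) in auto)
  have finR: "finite ?R"
    by (rule finite_subset[OF _ finite_mixed_Image[OF H, of h h "h i"]])
      (auto simp: quotient_trigraph_def)
  have "red ?T `` {l} \<subseteq> Pair c ` (?R \<union> h ` ?N)"
  proof
    fix y assume "y \<in> red ?T `` {l}"
    then obtain i' j where y: "y = (c, h j)" "h j \<noteq> h i" "(i', j) \<in> parcs H" "h i' = h i"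
      by (auto simp: i(1) quotient_trigraph_def mixed_def touch_def tensor_product_def)
    show "y \<in> Pair c ` (?R \<union> h ` ?N)"
    \<comment> \<open>The fixed representative \<open>i\<close> decides: if it is not joined to
      \<open>j\<close>, the two fibres are already mixed in \<open>H\<close>; otherwise
      \<open>h j\<close> is the label of a neighbour of \<open>i\<close>.\<close>
    proof (cases "(i, j) \<in> parcs H")
      case False
      then have "(h i, h j) \<in> miss H h h" using i(2) y(3) finV(2) by (auto simp: miss_def)
      moreover have "(h i, h j) \<in> touch H h h"
        using y(3,4) by (force simp: touch_def)
      ultimately show ?thesis using y by (auto simp: quotient_trigraph_def mixed_def)
    qed (use y in auto)
  qed
  then have "card (red ?T `` {l}) \<le> card (Pair c ` (?R \<union> h ` ?N))"
    using finN finR by (intro card_mono) auto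
  also have "\<dots> \<le> card ?R + card ?N"
    using card_Un_le[of ?R "h ` ?N"] card_image_le[OF finN, of h]
    by (simp add: card_image inj_on_def)
  also have "\<dots> \<le> s + max_degree H"
    using b i(2) card_nbrs_le_max_degree[OF finV(1) i(2)]
    by (intro add_mono) (auto simp: red_bounded_def quotient_trigraph_def)
  finally show "card (red ?T `` {l}) \<le> s + max_degree H" .
qed

section \<open>Joining the two phases\<close>

theorem theorem3p4:
  fixes G :: "'a pair_pre_digraph" and H :: "'b pair_pre_digraph"
  assumes "pair_graph G" and "pair_graph H"
  shows "tww (G \<times>\<^sub>t H) \<le> max (tww G * max_degree H + max_degree H) (tww H) + max_degree H"
proof (cases "pverts G = {} \<or> pverts H = {}")
  case True
  then have "pverts (G \<times>\<^sub>t H) = {}" by (auto simp: tensor_product_def)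
  then show ?thesis by (simp add: tww_empty)
next
  case False
  let ?P = "G \<times>\<^sub>t H"
  let ?reach = "\<lambda>F. (contracts_to (max (tww G * max_degree H + max_degree H) (tww H) + max_degree H))\<^sup>*\<^sup>*
    (quotient_trigraph ?P id) (quotient_trigraph ?P F)"
  have P: "pair_graph ?P" using assms by (rule pair_graph_tensor_product)
  obtain f c where f: "?reach (map_prod f id)" "f ` pverts G = {c}"
  proof (rule tww_induct[OF assms(1), of "\<lambda>f. ?reach (map_prod f id)"])
    fix f u v w
    assume "?reach (map_prod f id)" and m: "mergeable (f ` pverts G) u v w"
      "red_bounded (tww G) (quotient_trigraph G f)"
      "red_bounded (tww G) (quotient_trigraph G (merge u v w \<circ> f))"
    note this(1)
    also have "(contracts_to (max (tww G * max_degree H + max_degree H) (tww H) + max_degree H))\<^sup>*\<^sup>*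
      (quotient_trigraph ?P (map_prod f id)) (quotient_trigraph ?P (map_prod (merge u v w \<circ> f) id))"
      \<comment> \<open>With t = \<open>tww G\<close>, the phase-one bound (t + 2)\<Delta>(H) is the
        first argument of the maximum plus \<Delta>(H).\<close>
      by (rule contracts_to_merge_copies[OF assms m(1) refl m(2,3)]) simp
    finally show "?reach (map_prod (merge u v w \<circ> f) id)" .
  qed (use False in \<open>auto simp: prod.map_id0\<close>)
  \<comment> \<open>\<open>f\<close> is constant on the vertices of \<open>G\<close> only; an
    everywhere constant map gives the merges of phase two the form of merges of pairs.\<close>
  have c: "?reach (map_prod (\<lambda>_. c) id)"
  proof -
    have "quotient_trigraph ?P (map_prod (\<lambda>_. c) id) = quotient_trigraph ?P (map_prod f id)"
      using f(2) by (intro quotient_trigraph_cong[OF P]) (auto simp: tensor_product_def)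
    with f(1) show ?thesis by simp
  qed
  obtain h e where h: "?reach (map_prod (\<lambda>_. c) h)" "h ` pverts H = {e}"
  proof (rule tww_induct[OF assms(2), of "\<lambda>h. ?reach (map_prod (\<lambda>_. c) h)"])
    fix h u v w
    assume r: "?reach (map_prod (\<lambda>_. c) h)" and m: "mergeable (h ` pverts H) u v w"
      and b: "red_bounded (tww H) (quotient_trigraph H (merge u v w \<circ> h))"
    have F: "map_prod (\<lambda>_. c) (merge u v w \<circ> h) = merge (c, u) (c, v) (c, w) \<circ> map_prod (\<lambda>_. c) h"
      by (auto simp: merge_def fun_eq_iff)
    have "map_prod (\<lambda>_. c) h ` pverts ?P = {c} \<times> h ` pverts H"
      using False by (auto simp: tensor_product_def image_iff)
    then have "mergeable (map_prod (\<lambda>_. c) h ` pverts ?P) (c, u) (c, v) (c, w)"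
      using m by (auto simp: mergeable_def)
    \<comment> \<open>The phase-two bound \<open>tww H + max_degree H\<close> is covered by the
      second argument of the maximum.\<close>
    from contracts_to_quotient[OF P this
        red_bounded_mono[OF red_bounded_tensor_collapsed[OF assms(2) b, of G c, unfolded F]]] r
    show "?reach (map_prod (\<lambda>_. c) (merge u v w \<circ> h))"
      unfolding F by (meson add_le_mono1 max.cobounded2 rtranclp.rtrancl_into_rtrancl)
  qed (use False c in auto)
  have "map_prod (\<lambda>_. c) h ` pverts ?P = {(c, e)}"
    using False h(2) by (auto simp: tensor_product_def image_iff)
  then show ?thesis by (rule tww_le_if_contracts_to[OF P h(1)])
qed

end
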